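(* Let $b \in \{1,2,3\}$. Put $x_0 := 1$ if $b$ is odd and $x_0 := 2$ if $b$ is even, and put $a_0 := b+2$. Then for every integer $a \geq a_0$ and every real number $x > x_0$, $$\Delta_{a,b}(x) = P_{a-1}(x)\,P_{b+1}(x) - P_a(x)\,P_b(x) > 0.$$
   Context: The polynomials $P_n(x)$, $n \geq 0$, are defined by the generating function $\sum_{n=0}^{\infty} P_n(z)\, q^n = \prod_{n=1}^{\infty} (1-q^n)^{-z}$ for $q,z \in \mathbb{C}$, $|q|<1$ (so $P_0(x)=1$, $P_1(x)=x$, $P_2(x)=x(x+3)/2$, and $P_n(k)$ is the number of $k$-colored partitions of $n$). For integers $a > b \geq 0$, $\Delta_{a,b}(x) := P_{a-1}(x)P_{b+1}(x) - P_a(x)P_b(x)$. *)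

theory Defs
  imports "HOL-Complex_Analysis.Complex_Analysis"
begin

text \<open>
  The powers of \<open>1 - q ^ n\<close> are principal ones; since \<open>norm q < 1\<close>, the base always has
  positive real part. The index is shifted so that the product starts with \<open>1 - q\<close>.
\<close>

definition colored_partition_gf :: "complex \<Rightarrow> complex \<Rightarrow> complex" where
  "colored_partition_gf z q = (\<Prod>n. (1 - q ^ Suc n) powr (- z))"

text \<open>
  The polynomials have rational coefficients. They are represented as real polynomials, and their
  coefficients are embedded into the complex numbers to state the generating function identity.
\<close>

definition generated_polys :: "(nat \<Rightarrow> real poly) \<Rightarrow> bool" where
  "generated_polys P \<longleftrightarrow> (\<forall>z q :: complex. norm q < 1 \<longrightarrow>
     (\<lambda>n. poly (map_poly of_real (P n)) z * q ^ n) sums colored_partition_gf z q)"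

text \<open>
  The lemma \<open>ex1_generated_polys\<close> below shows that this description is proper.
\<close>

definition colored_partition_poly :: "nat \<Rightarrow> real poly" where
  "colored_partition_poly = (THE P. generated_polys P)"

text \<open>
  This is only meant for \<open>a > b\<close>, so that \<open>a - 1\<close> is not truncated.
\<close>

definition Delta :: "nat \<Rightarrow> nat \<Rightarrow> real \<Rightarrow> real" where
  "Delta a b x =
     poly (colored_partition_poly (a - 1)) x * poly (colored_partition_poly (b + 1)) x
     - poly (colored_partition_poly a) x * poly (colored_partition_poly b) x"


lemma one_minus_power_notin_nonpos_Reals:
  fixes q :: complex
  assumes "norm q < 1"
  shows "1 - q ^ Suc n \<notin> \<real>\<^sub>\<le>\<^sub>0"
proof -
  have "norm (q ^ Suc n) < 1"
    using assms by (simp add: norm_power power_less_one_iff del: power_Suc)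
  hence "Re (q ^ Suc n) < 1"
    using complex_Re_le_cmod le_less_trans by blast
  thus ?thesis
    by (auto simp: complex_nonpos_Reals_iff simp del: power_Suc)
qed

definition log_gf :: "complex \<Rightarrow> complex" where
  "log_gf q = (\<Sum>n. Ln (1 - q ^ Suc n))"

lemma eventually_norm_Ln_le:
  assumes "0 \<le> r" "r < 1"
  shows "\<forall>\<^sub>F n in sequentially. \<forall>q\<in>cball (0::complex) r. norm (Ln (1 - q ^ Suc n)) \<le> 2 * r ^ Suc n"
proof -
  have "(\<lambda>n. r ^ Suc n) \<longlonglongrightarrow> 0"
    using LIMSEQ_Suc[OF LIMSEQ_realpow_zero[OF assms]] by simp
  hence "\<forall>\<^sub>F n in sequentially. r ^ Suc n < 1/2"
    by (rule order_tendstoD) auto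
  thus ?thesis
  proof eventually_elim
    case (elim n)
    show ?case
    proof
      fix q :: complex assume "q \<in> cball 0 r"
      hence le: "norm (q ^ Suc n) \<le> r ^ Suc n"
        unfolding norm_power by (intro power_mono) auto
      have "norm (Ln (1 + (- (q ^ Suc n)))) \<le> 2 * norm (- (q ^ Suc n))"
        using le elim by (intro norm_Ln_le) (simp del: power_Suc)
      thus "norm (Ln (1 - q ^ Suc n)) \<le> 2 * r ^ Suc n"
        using le by (simp del: power_Suc)
    qed
  qed
qed

lemma summable_bound:
  fixes r :: real
  assumes "0 \<le> r" "r < 1"
  shows "summable (\<lambda>n. 2 * r ^ Suc n)"
  using assms by (intro summable_mult) (simp add: summable_mult summable_geometric)

lemma summable_log_gf:
  assumes "norm q < 1"
  shows "summable (\<lambda>n. Ln (1 - q ^ Suc n))"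
proof (rule summable_comparison_test_ev)
  show "\<forall>\<^sub>F n in sequentially. norm (Ln (1 - q ^ Suc n)) \<le> 2 * norm q ^ Suc n"
    using eventually_norm_Ln_le[of "norm q"] assms by (auto elim!: eventually_mono)
qed (use summable_bound[of "norm q"] assms in auto)

lemma holomorphic_log_gf: "log_gf holomorphic_on ball 0 1"
proof (rule holomorphic_uniform_sequence[of _ "\<lambda>N q. \<Sum>n<N. Ln (1 - q ^ Suc n)"])
  fix N
  show "(\<lambda>q. \<Sum>n<N. Ln (1 - q ^ Suc n)) holomorphic_on ball 0 1"
    by (intro holomorphic_intros) (use one_minus_power_notin_nonpos_Reals in auto)
next
  fix x :: complex assume x: "x \<in> ball 0 1"
  define d where "d = (1 - norm x) / 2"
  have d: "0 < d" "norm x + d < 1" using x by (auto simp: d_def field_simps)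
  have sub: "cball x d \<subseteq> cball 0 (norm x + d)"
    by (auto simp: dist_norm) (smt (verit) norm_minus_commute norm_triangle_sub)
  have "uniform_limit (cball 0 (norm x + d)) (\<lambda>N q. \<Sum>n<N. Ln (1 - q ^ Suc n)) log_gf sequentially"
    unfolding log_gf_def using d
    by (intro Weierstrass_m_test_ev[OF eventually_norm_Ln_le summable_bound]) auto
  hence "uniform_limit (cball x d) (\<lambda>N q. \<Sum>n<N. Ln (1 - q ^ Suc n)) log_gf sequentially"
    using sub by (rule uniform_limit_on_subset)
  moreover have "cball x d \<subseteq> ball 0 1"
    using sub d by (auto simp: subset_iff)
  ultimately show "\<exists>d>0. cball x d \<subseteq> ball 0 1 \<and>
      uniform_limit (cball x d) (\<lambda>N q. \<Sum>n<N. Ln (1 - q ^ Suc n)) log_gf sequentially"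
    using d by blast
qed auto

lemma powr_eq_exp:
  assumes "norm q < 1"
  shows "(1 - q ^ Suc n) powr (- z) = exp (- z * Ln (1 - q ^ Suc n))"
  using one_minus_power_notin_nonpos_Reals[OF assms, of n] by (auto simp: powr_def)

lemma convergent_prod_colored_partition_gf:
  fixes q z :: complex
  assumes "norm q < 1"
  shows "convergent_prod (\<lambda>n. (1 - q ^ Suc n) powr (- z))"
  unfolding powr_eq_exp[OF assms]
  using sums_imp_has_prod_exp[OF summable_sums[OF summable_mult[OF summable_log_gf[OF assms]]]]
  unfolding convergent_prod_def by blast

lemma colored_partition_gf_eq:
  assumes "norm q < 1"
  shows "colored_partition_gf z q = exp (- z * log_gf q)"
  unfolding colored_partition_gf_def powr_eq_exp[OF assms] log_gf_def
  using summable_log_gf[OF assms] by (simp only: prodinf_exp summable_mult suminf_mult)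

lemma log_gf_cnj:
  assumes "norm q < 1"
  shows "log_gf (cnj q) = cnj (log_gf q)"
proof -
  have "(\<lambda>n. cnj (Ln (1 - q ^ Suc n))) sums cnj (log_gf q)"
    unfolding sums_cnj log_gf_def using summable_log_gf[OF assms] by (rule summable_sums)
  also have "(\<lambda>n. cnj (Ln (1 - q ^ Suc n))) = (\<lambda>n. Ln (1 - cnj q ^ Suc n))"
    using one_minus_power_notin_nonpos_Reals[OF assms] by (simp add: cnj_Ln)
  finally show ?thesis
    unfolding log_gf_def by (simp add: sums_iff)
qed

lemma has_fps_expansion_of_sums:
  fixes f :: "complex \<Rightarrow> complex"
  assumes "\<And>q. norm q < 1 \<Longrightarrow> (\<lambda>n. c n * q ^ n) sums f q"
  shows "f has_fps_expansion Abs_fps c"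
proof (rule has_fps_expansionI)
  have "\<forall>\<^sub>F u :: complex in nhds 0. u \<in> ball 0 1"
    by (intro eventually_nhds_in_open) auto
  thus "\<forall>\<^sub>F u in nhds 0. (\<lambda>n. fps_nth (Abs_fps c) n * u ^ n) sums f u"
    by eventually_elim (use assms in auto)
qed

lemma has_fps_expansion_log_gf: "log_gf has_fps_expansion fps_expansion log_gf 0"
  using holomorphic_log_gf by (intro has_fps_expansion_fps_expansion) auto

lemma log_gf_coeffs_real: "fps_nth (fps_expansion log_gf 0) n \<in> \<real>"
proof -
  define c where "c = fps_nth (fps_expansion log_gf 0)"
  have sums: "(\<lambda>n. c n * q ^ n) sums log_gf q" if "norm q < 1" for q
    unfolding c_def
    using has_fps_expansion_imp_sums_complex[OF has_fps_expansion_log_gf, of 1 q]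
      holomorphic_log_gf that by (simp add: one_ereal_def)
  have "(\<lambda>n. cnj (c n) * q ^ n) sums log_gf q" if "norm q < 1" for q
  proof -
    have "(\<lambda>n. cnj (c n * cnj q ^ n)) sums cnj (log_gf (cnj q))"
      unfolding sums_cnj by (rule sums) (use that in auto)
    thus ?thesis using that by (simp add: log_gf_cnj)
  qed
  hence "log_gf has_fps_expansion Abs_fps (\<lambda>n. cnj (c n))"
    by (rule has_fps_expansion_of_sums)
  with has_fps_expansion_log_gf have "fps_expansion log_gf 0 = Abs_fps (\<lambda>n. cnj (c n))"
    by (rule fps_expansion_unique_complex)
  hence "c n = cnj (c n)"
    unfolding c_def by (metis fps_nth_Abs_fps)
  thus ?thesis
    by (simp add: c_def Reals_cnj_iff)
qed

lemma fps_power_coeffs_real: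
  fixes F :: "complex fps"
  assumes "\<And>n. fps_nth F n \<in> \<real>"
  shows "fps_nth (F ^ i) n \<in> \<real>"
  by (induction i arbitrary: n) (auto simp: fps_mult_nth assms intro!: sum_in_Reals Reals_mult)

lemma poly_map_poly_of_real:
  "poly (map_poly of_real p) (of_real x :: complex) = of_real (poly p x)"
  by (induction p) (auto simp: map_poly_pCons)

lemma ex_generated_polys: "\<exists>P. generated_polys P"
proof -
  define L where "L = - fps_expansion log_gf 0"
  define P :: "nat \<Rightarrow> real poly"
    where "P n = (\<Sum>i\<in>{0..n}. monom (Re (fps_nth (L ^ i) n) / fact i) i)" for n
  have L: "(\<lambda>q. - log_gf q) has_fps_expansion L"
    unfolding L_def by (intro fps_expansion_intros has_fps_expansion_log_gf)
  have "log_gf 0 = 0"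
    by (simp add: log_gf_def)
  hence L0: "fps_nth L 0 = 0"
    by (simp add: L_def fps_expansion_def)
  have real: "of_real (Re (fps_nth (L ^ i) n)) = fps_nth (L ^ i) n" for i n
    using fps_power_coeffs_real[of L i n] log_gf_coeffs_real by (simp add: L_def)
  have coeff: "poly (map_poly of_real (P n)) z = fps_nth (fps_exp z oo L) n" for n and z :: complex
  proof -
    have "map_poly of_real (P n) =
        (\<Sum>i\<in>{0..n}. monom (fps_nth (L ^ i) n / fact i) i)"
      by (intro poly_eqI) (simp add: P_def coeff_map_poly coeff_sum if_distrib[of of_real] real cong: if_cong)
    thus ?thesis
      by (simp add: poly_sum poly_monom fps_compose_nth mult_ac)
  qed
  have "(\<lambda>n. poly (map_poly of_real (P n)) z * q ^ n) sums colored_partition_gf z q"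
    if q: "norm q < 1" for z q :: complex
  proof -
    have "((\<lambda>w. exp (z * w)) \<circ> (\<lambda>q. - log_gf q)) has_fps_expansion (fps_exp z oo L)"
      by (intro has_fps_expansion_compose has_fps_expansion_exp L L0)
    hence "(\<lambda>n. fps_nth (fps_exp z oo L) n * q ^ n) sums
             ((\<lambda>w. exp (z * w)) \<circ> (\<lambda>q. - log_gf q)) q"
    proof (rule has_fps_expansion_imp_sums_complex)
      show "((\<lambda>w. exp (z * w)) \<circ> (\<lambda>q. - log_gf q)) holomorphic_on eball 0 1"
        unfolding o_def one_ereal_def
        by (intro holomorphic_intros) (use holomorphic_log_gf in simp)
    qed (use q in \<open>simp add: one_ereal_def\<close>)
    thus ?thesis
      using q by (simp add: coeff colored_partition_gf_eq)
  qed
  thus ?thesis unfolding generated_polys_def by blast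
qed

lemma generated_polys_unique:
  assumes "generated_polys P" "generated_polys Q"
  shows "P = Q"
proof
  fix n
  have *: "colored_partition_gf z has_fps_expansion Abs_fps (\<lambda>n. poly (map_poly of_real (R n)) z)"
    if "generated_polys R" for R z
    using that unfolding generated_polys_def by (intro has_fps_expansion_of_sums) auto
  have eq: "Abs_fps (\<lambda>n. poly (map_poly of_real (P n)) z)
      = Abs_fps (\<lambda>n. poly (map_poly of_real (Q n)) z)" for z :: complex
    by (rule fps_expansion_unique_complex[OF *[OF assms(1)] *[OF assms(2)]])
  have "poly (map_poly of_real (P n)) z = poly (map_poly of_real (Q n)) z" for z :: complex
    using arg_cong[OF eq[of z], of "\<lambda>F. fps_nth F n"] by simp
  from this[of "of_real x" for x] show "P n = Q n"
    by (intro poly_ext) (simp add: poly_map_poly_of_real)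
qed

lemma ex1_generated_polys: "\<exists>!P. generated_polys P"
  using ex_generated_polys generated_polys_unique by blast

lemma generated_polys_colored_partition_poly: "generated_polys colored_partition_poly"
  unfolding colored_partition_poly_def by (rule theI'[OF ex1_generated_polys])

end

theory Submission
  imports Defs
begin

text \<open>
  Logarithmic differentiation of the product gives \<open>n P\<^sub>n = x (\<Sum>k<n. \<sigma>(n - k) P\<^sub>k)\<close>. Put
  \<open>c = P\<^bsub>b+1\<^esub> / P\<^sub>b\<close> and \<open>A\<^sub>j = c P\<^bsub>j-1\<^esub> - P\<^sub>j\<close>; the claim is \<open>A\<^sub>n > 0\<close> for \<open>n \<ge> b + 2\<close>. The recurrence
  yields \<open>n A\<^sub>n = c P\<^bsub>n-1\<^esub> + x (\<Sum>j=1..<n. \<sigma>(n - j) A\<^sub>j) - x \<sigma>(n)\<close>, and \<open>A\<^bsub>b+1\<^esub> = 0\<close>, so by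
  induction all terms with \<open>j > b\<close> can be dropped. What remains is a polynomial inequality in which
  \<open>P\<^bsub>n-1\<^esub>\<close> is bounded below by a cubic in \<open>x\<close>: for \<open>n < 12\<close> with explicit coefficients, for \<open>n \<ge> 12\<close> by
  \<open>(n - 5)(n - 6) x\<^sup>3\<close>, against \<open>\<sigma>(n) \<le> n\<^sup>2/8 + 5n/4\<close>.
\<close>

section \<open>Power series of \<open>log_gf\<close> and the recurrence for the polynomials\<close>

text \<open>Every number divides 0, so for \<open>n = 0\<close> the index set is infinite and the
  sum is 0 by convention.\<close>

definition divisor_sum :: "nat \<Rightarrow> nat" where
  "divisor_sum n = (\<Sum>d | d dvd n. d)"

text \<open>Each \<open>- Ln (1 - q ^ Suc k)\<close> is expanded into its logarithm series, and the
  double series is regrouped by the exponent \<open>m = (k + 1) * j\<close>. With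
  \<open>d = k + 1\<close>, the factor \<open>1 / j\<close> becomes \<open>d / m\<close>.\<close>

lemma log_gf_sums:
  assumes "norm q < 1"
  shows "(\<lambda>n. - of_nat (divisor_sum n) / of_nat n * q ^ n) sums log_gf q"
proof -
  define f :: "nat \<times> nat \<Rightarrow> complex" where "f = (\<lambda>(k, j). q ^ (Suc k * j) / of_nat j)"
  define r where "r = norm q"
  have r: "0 \<le> r" "r < 1" using assms by (auto simp: r_def)
  have geom: "((\<lambda>n. r ^ n) has_sum 1 / (1 - r)) UNIV"
    using r geometric_sums[of r] by (intro sums_nonneg_imp_has_sum) auto
  \<comment> \<open>This product of geometric series dominates \<open>f\<close>, which permits any
    order of summation.\<close>
  have "(\<lambda>(k, j). r ^ k * r ^ j) summable_on UNIV \<times> UNIV"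
  proof (rule summable_on_SigmaI)
    show "((\<lambda>j. case (k, j) of (k, j) \<Rightarrow> r ^ k * r ^ j) has_sum r ^ k * (1 / (1 - r))) UNIV" for k
      using has_sum_cmult_right[OF geom, of "r ^ k"] by simp
    show "(\<lambda>k. r ^ k * (1 / (1 - r))) summable_on UNIV"
      using geom by (intro summable_on_cmult_left) (auto simp: summable_on_def)
  qed (use r in auto)
  moreover have "norm (f z) \<le> (case z of (k, j) \<Rightarrow> r ^ k * r ^ j)" for z
  proof (cases z)
    case (Pair k j)
    show ?thesis
    proof (cases "j = 0")
      case False
      have "norm (f z) = r ^ (Suc k * j) / real j"
        by (simp add: Pair f_def norm_divide norm_power r_def del: mult_Suc)
      also have "\<dots> \<le> r ^ (Suc k * j) / 1"
        using False r by (intro divide_left_mono) auto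
      also have "\<dots> \<le> r ^ (k + j)"
        using False r by (auto intro!: power_decreasing)
      finally show ?thesis by (simp add: Pair power_add)
    qed (use r in \<open>simp add: f_def Pair\<close>)
  qed
  ultimately have "(\<lambda>z. norm (f z)) summable_on UNIV \<times> UNIV"
    by (rule Infinite_Sum.abs_summable_on_comparison_test')
  hence summable: "f summable_on UNIV \<times> UNIV"
    by (rule Infinite_Sum.abs_summable_summable)
  then obtain T where T: "(f has_sum T) (UNIV \<times> UNIV)"
    by (auto simp: summable_on_def)

  have "((\<lambda>j. f (k, j)) has_sum - Ln (1 - q ^ Suc k)) UNIV" for k
  proof -
    have "(\<lambda>j. f (k, j)) = (\<lambda>j. (q ^ Suc k) ^ j / of_nat j)"
      by (simp add: f_def power_mult del: power_Suc mult_Suc)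
    moreover have "norm (- (q ^ Suc k)) < 1"
      using assms by (simp add: norm_power power_less_one_iff del: power_Suc)
    note sums_minus[OF Ln_series'[OF this]]
    ultimately have "(\<lambda>j. f (k, j)) sums - Ln (1 - q ^ Suc k)" by simp
    moreover have "(\<lambda>j. f (k, j)) summable_on UNIV"
      using summable_on_SigmaD1[of "\<lambda>k j. f (k, j)" UNIV "\<lambda>_. UNIV" k] summable by simp
    ultimately show ?thesis
      using has_sum_imp_sums sums_unique2 summable_iff_has_sum_infsum by metis
  qed
  hence "((\<lambda>k. - Ln (1 - q ^ Suc k)) has_sum T) UNIV"
    by (intro has_sum_SigmaD[OF T])
  hence "(\<lambda>k. - Ln (1 - q ^ Suc k)) sums T"
    by (rule has_sum_imp_sums)
  moreover have "(\<lambda>k. - Ln (1 - q ^ Suc k)) sums - log_gf q"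
    unfolding log_gf_def by (intro sums_minus summable_sums summable_log_gf assms)
  ultimately have T_eq: "T = - log_gf q"
    by (rule sums_unique2)

  \<comment> \<open>The terms with \<open>j = 0\<close> vanish because division by zero yields
    0.\<close>
  have "(f has_sum T) (UNIV \<times> UNIV) \<longleftrightarrow> (f has_sum T) (UNIV \<times> {1..})"
    by (rule has_sum_cong_neutral) (auto simp: f_def)
  also have "\<dots> \<longleftrightarrow> ((\<lambda>(m, d). of_nat d / of_nat m * q ^ m) has_sum T) (SIGMA m:{1..}. {d. d dvd m})"
    by (rule has_sum_reindex_bij_witness[of _ "\<lambda>(m, d). (d - 1, m div d)" "\<lambda>(k, j). (Suc k * j, Suc k)"])
      (auto simp: f_def Suc_le_eq simp del: mult_Suc of_nat_Suc elim!: dvdE)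
  finally have "((\<lambda>(m, d). of_nat d / of_nat m * q ^ m) has_sum T) (SIGMA m:{1..}. {d. d dvd m})"
    using T by simp
  hence "((\<lambda>m. of_nat (divisor_sum m) / of_nat m * q ^ m) has_sum T) {1..}"
    by (rule has_sum_SigmaD)
      (auto simp: divisor_sum_def of_nat_sum sum_divide_distrib sum_distrib_right intro!: has_sum_finiteI)
  also have "?this \<longleftrightarrow> ((\<lambda>m. of_nat (divisor_sum m) / of_nat m * q ^ m) has_sum T) UNIV"
    by (rule has_sum_cong_neutral) (auto simp: not_less_eq_eq)
  finally have "(\<lambda>m. of_nat (divisor_sum m) / of_nat m * q ^ m) sums T"
    by (rule has_sum_imp_sums)
  thus ?thesis
    using sums_minus T_eq by fastforce
qed

text \<open>The generating function is the exponential of \<open>z\<close> times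
  \<open>- log_gf\<close>; uniqueness of power series expansions turns this into a formal
  identity.\<close>

lemma colored_partition_poly_fps:
  fixes z :: complex
  defines "p \<equiv> \<lambda>n. poly (map_poly of_real (colored_partition_poly n)) z"
  defines "L \<equiv> Abs_fps (\<lambda>n. of_nat (divisor_sum n) / of_nat n)"
  shows "Abs_fps p = fps_exp z oo L"
proof -
  have "log_gf has_fps_expansion Abs_fps (\<lambda>n. - of_nat (divisor_sum n) / of_nat n)"
    by (rule has_fps_expansion_of_sums[OF log_gf_sums])
  also have "Abs_fps (\<lambda>n. - of_nat (divisor_sum n) / of_nat n) = - L"
    by (simp add: L_def fps_eq_iff)
  finally have "(\<lambda>q. - log_gf q) has_fps_expansion L"
    using has_fps_expansion_minus by fastforce
  moreover have "fps_nth L 0 = 0" by (simp add: L_def)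
  ultimately have "((\<lambda>w. exp (z * w)) \<circ> (\<lambda>q. - log_gf q)) has_fps_expansion (fps_exp z oo L)"
    by (intro has_fps_expansion_compose has_fps_expansion_exp)
  moreover have "\<forall>\<^sub>F q in nhds 0. ((\<lambda>w. exp (z * w)) \<circ> (\<lambda>q. - log_gf q)) q = colored_partition_gf z q"
    using eventually_nhds_in_open[of "ball 0 1" "0::complex"]
    by (auto elim!: eventually_mono simp: colored_partition_gf_eq)
  ultimately have "colored_partition_gf z has_fps_expansion (fps_exp z oo L)"
    using has_fps_expansion_cong by blast
  moreover have "colored_partition_gf z has_fps_expansion Abs_fps p"
    using generated_polys_colored_partition_poly
    unfolding generated_polys_def p_def by (intro has_fps_expansion_of_sums) auto
  ultimately show ?thesis
    using fps_expansion_unique_complex by blast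
qed

lemma poly_colored_partition_poly_0: "poly (colored_partition_poly 0) x = 1"
proof -
  have "poly (map_poly of_real (colored_partition_poly 0)) (of_real x :: complex) = 1"
    using arg_cong[OF colored_partition_poly_fps[of "of_real x"], of "\<lambda>F. fps_nth F 0"] by simp
  thus ?thesis
    by (simp add: poly_map_poly_of_real)
qed

text \<open>Compare coefficients in \<open>F' = z F L'\<close>, where \<open>F\<close> is the
  generating series. Differentiating \<open>L\<close> cancels its denominators and leaves the
  divisor sums.\<close>

lemma poly_colored_partition_poly_rec:
  "n * poly (colored_partition_poly n) x =
     x * (\<Sum>k<n. divisor_sum (n - k) * poly (colored_partition_poly k) x)"
proof (cases n)
  case (Suc m)
  define z :: complex where "z = of_real x"
  define p where "p n = poly (map_poly of_real (colored_partition_poly n)) z" for n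
  define L :: "complex fps" where "L = Abs_fps (\<lambda>n. of_nat (divisor_sum n) / of_nat n)"
  have eq: "Abs_fps p = fps_exp z oo L"
    unfolding p_def L_def by (rule colored_partition_poly_fps)
  have "fps_deriv (fps_exp z oo L) = fps_const z * (fps_exp z oo L) * fps_deriv L"
    by (simp add: fps_compose_deriv L_def fps_const_mult_apply_left)
  hence "fps_nth (fps_deriv (Abs_fps p)) m = z * fps_nth (Abs_fps p * fps_deriv L) m"
    unfolding fps_mult_left_const_nth [symmetric] by (simp add: eq mult.assoc)
  hence "of_nat n * p n = z * (\<Sum>k=0..m. p k * (of_nat (Suc (m - k)) * fps_nth L (Suc (m - k))))"
    by (simp add: Suc fps_mult_nth del: of_nat_Suc)
  also have "(\<Sum>k=0..m. p k * (of_nat (Suc (m - k)) * fps_nth L (Suc (m - k)))) =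
      (\<Sum>k<n. of_nat (divisor_sum (n - k)) * p k)"
    by (intro sum.cong) (auto simp: Suc L_def Suc_diff_le simp del: of_nat_Suc)
  finally have "complex_of_real (n * poly (colored_partition_poly n) x) =
     complex_of_real (x * (\<Sum>k<n. divisor_sum (n - k) * poly (colored_partition_poly k) x))"
    by (simp add: p_def z_def poly_map_poly_of_real)
  thus ?thesis
    by (simp only: of_real_eq_iff)
qed auto

section \<open>Values and bounds of the divisor sum\<close>

text \<open>An executable form, for the evaluations by \<open>code_simp\<close>.\<close>

lemma divisor_sum_eq_sum_list [code]:
  "divisor_sum n = sum_list (filter (\<lambda>d. d dvd n) [1..<Suc n])"
proof (cases "n = 0")
  case False
  hence "{d. d dvd n} = set (filter (\<lambda>d. d dvd n) [1..<Suc n])"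
    by (auto simp: less_Suc_eq_le dvd_imp_le intro!: Suc_leI dest: dvd_pos_nat)
  thus ?thesis
    unfolding divisor_sum_def
    using sum.distinct_set_conv_list[of "filter (\<lambda>d. d dvd n) [1..<Suc n]" "\<lambda>d. d"] by simp
qed (simp add: divisor_sum_def)

lemma divisor_sum_numeral:
  "divisor_sum (Suc 0) = 1"
  "divisor_sum 1 = 1" "divisor_sum 2 = 3" "divisor_sum 3 = 4" "divisor_sum 4 = 7" "divisor_sum 5 = 6"
  "divisor_sum 6 = 12" "divisor_sum 7 = 8" "divisor_sum 8 = 15" "divisor_sum 9 = 13" "divisor_sum 10 = 18"
  "divisor_sum 11 = 12" "divisor_sum 12 = 28" "divisor_sum 13 = 14" "divisor_sum 14 = 24" "divisor_sum 15 = 24"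
  "divisor_sum 16 = 31" "divisor_sum 17 = 18" "divisor_sum 18 = 39" "divisor_sum 19 = 20" "divisor_sum 20 = 42"
  by code_simp+

lemma le_divisor_sum: "n \<le> divisor_sum n"
proof (cases "n = 0")
  case False
  thus ?thesis
    unfolding divisor_sum_def by (intro member_le_sum) auto
qed auto

text \<open>A divisor other than \<open>n\<close> is at most \<open>n div 2\<close>, so the divisors
  sum to at most \<open>n\<close> plus \<open>1 + ... + n div 2\<close>.\<close>

lemma divisor_sum_le: "real (divisor_sum n) \<le> n ^ 2 / 8 + 5 * n / 4"
proof (cases "n = 0")
  case False
  define m where "m = n div 2"
  have "{d. d dvd n} \<subseteq> insert n {..m}"
  proof
    fix d assume "d \<in> {d. d dvd n}"
    then obtain k where k: "n = d * k" by auto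
    show "d \<in> insert n {..m}"
    proof (cases "k \<le> 1")
      case True
      with k False have "k = 1" by (cases k) auto
      with k show ?thesis by simp
    next
      case False
      hence "d * 2 \<le> n" unfolding k by (intro mult_left_mono) auto
      thus ?thesis by (auto simp: m_def)
    qed
  qed
  hence "divisor_sum n \<le> \<Sum>(insert n {..m})"
    unfolding divisor_sum_def by (intro sum_mono2) auto
  also have "\<dots> = n + \<Sum>{0..m}"
    using False by (subst sum.insert) (auto simp: m_def atLeast0AtMost)
  also have "\<Sum>{0..m} = m * Suc m div 2"
    by (rule gauss_sum_nat)
  finally have "real (divisor_sum n) \<le> n + real (m * Suc m div 2)"
    by linarith
  also have "real (m * Suc m div 2) \<le> real m * (real m + 1) / 2"
    using of_nat_div_le_of_nat[of "m * Suc m" 2, where ?'a = real] by (simp add: algebra_simps)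
  also have "\<dots> \<le> (n / 2) * (n / 2 + 1) / 2"
    by (intro divide_right_mono mult_mono) (auto simp: m_def)
  finally show ?thesis
    by (simp add: field_simps power2_eq_square)
qed (simp add: divisor_sum_def)

section \<open>The recurrence at a fixed argument and the induction on ratios\<close>

text \<open>From here on the polynomials enter only through their values at one \<open>x\<close>,
  and these only through the initial value and the recurrence.\<close>

locale colored_partition_values =
  fixes x :: real and p :: "nat \<Rightarrow> real"
  assumes p_0: "p 0 = 1"
    and p_rec: "n * p n = x * (\<Sum>k<n. divisor_sum (n - k) * p k)"
begin

lemma p_eq: "n > 0 \<Longrightarrow> p n = x * (\<Sum>k<n. divisor_sum (n - k) * p k) / n"
  using p_rec[of n] by (simp add: field_simps)

lemma p_nonneg: "x \<ge> 0 \<Longrightarrow> p n \<ge> 0"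
proof (induction n rule: less_induct)
  case (less n)
  show ?case
  proof (cases "n = 0")
    case False
    thus ?thesis
      using less by (subst p_eq) (auto intro!: divide_nonneg_nonneg mult_nonneg_nonneg sum_nonneg)
  qed (simp add: p_0)
qed

lemma p_small:
  "p 1 = x" "p 2 = x * (x + 3) / 2" "p 3 = x * (x + 1) * (x + 8) / 6"
  "p 4 = x * (x + 1) * (x + 3) * (x + 14) / 24"
proof -
  note [simp] = divisor_sum_numeral p_0 lessThan_nat_numeral
  show 1: "p 1 = x"
    by (simp add: p_eq)
  show 2: "p 2 = x * (x + 3) / 2"
    by (simp add: p_eq[of 2] 1[simplified])
  show 3: "p 3 = x * (x + 1) * (x + 8) / 6"
    by (simp add: p_eq[of 3] 1[simplified] 2) (simp add: field_simps)
  show "p 4 = x * (x + 1) * (x + 3) * (x + 14) / 24"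
    by (simp add: p_eq[of 4] 1[simplified] 2 3) (simp add: field_simps)
qed

text \<open>The right side of \<open>step\<close> minus its left side is
  \<open>n * (c * p (n - 1) - p n)\<close> without the summands for \<open>j > b\<close>. These are
  nonnegative: zero for \<open>j = b + 1\<close> by \<open>start\<close>, positive afterwards by
  induction.\<close>

lemma ratio_induct:
  assumes x: "x > 0"
    and start: "p (b + 1) = c * p b"
    and step: "\<And>n. n \<ge> b + 2 \<Longrightarrow> x * divisor_sum n <
      c * p (n - 1) + x * (\<Sum>j=1..b. divisor_sum (n - j) * (c * p (j - 1) - p j))"
    and n: "n \<ge> b + 2"
  shows "p n < c * p (n - 1)"
  using n
proof (induction n rule: less_induct)
  case (less n)
  define s where "s j = divisor_sum (n - j) * (c * p (j - 1) - p j)" for j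
  obtain m where m: "n = Suc m" using less.prems by (cases n) auto
  \<comment> \<open>The summand \<open>k = 0\<close> is split off, since \<open>p 0\<close> has no
    predecessor to be compared with.\<close>
  have "n * p n = x * (divisor_sum n + (\<Sum>j=1..<n. divisor_sum (n - j) * p j))"
    unfolding p_rec by (simp add: m lessThan_atLeast0 sum.atLeast_Suc_lessThan p_0)
  \<comment> \<open>The recurrence at \<open>n - 1\<close>, with the index shifted so that the
    weights agree with those at \<open>n\<close>.\<close>
  moreover have "m * p m = x * (\<Sum>j=1..<n. divisor_sum (n - j) * p (j - 1))"
    unfolding p_rec m by (subst One_nat_def, subst sum.shift_bounds_Suc_ivl) (simp add: lessThan_atLeast0)
  ultimately have "n * (c * p m - p n) = c * p m + x * (\<Sum>j=1..<n. s j) - x * divisor_sum n"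
    by (simp add: m s_def sum_subtractf sum_distrib_left algebra_simps)
  moreover have "(\<Sum>j=1..<n. s j) = (\<Sum>j=1..b. s j) + (\<Sum>j=b+1..<n. s j)"
    using less.prems
    by (subst sum.atLeastLessThan_concat[of 1 "b + 1" n, symmetric]) (auto simp: atLeastLessThanSuc_atLeastAtMost)
  ultimately have eq: "n * (c * p m - p n) =
      c * p m + x * ((\<Sum>j=1..b. s j) + (\<Sum>j=b+1..<n. s j)) - x * divisor_sum n"
    by simp
  have "(\<Sum>j=b+1..<n. s j) \<ge> 0"
  proof (intro sum_nonneg)
    fix j assume j: "j \<in> {b+1..<n}"
    show "s j \<ge> 0"
    proof (cases "j = b + 1")
      case False
      with j less.IH[of j] show ?thesis by (simp add: s_def)
    qed (use start in \<open>simp add: s_def\<close>)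
  qed
  hence "c * p m + x * (\<Sum>j=1..b. s j) - x * divisor_sum n \<le>
      c * p m + x * ((\<Sum>j=1..b. s j) + (\<Sum>j=b+1..<n. s j)) - x * divisor_sum n"
    using x by simp
  moreover have "c * p m + x * (\<Sum>j=1..b. s j) - x * divisor_sum n > 0"
    using step[OF less.prems] by (simp add: m s_def)
  ultimately have "0 < n * (c * p m - p n)"
    unfolding eq by linarith
  hence "0 < c * p m - p n"
    unfolding zero_less_mult_iff by linarith
  thus ?case
    by (simp add: m)
qed

end

section \<open>Cubic lower bounds for the values\<close>

text \<open>
  The linear and quadratic coefficients of \<open>P\<^sub>n\<close>. For \<open>x \<ge> 1\<close> all higher powers of \<open>x\<close> are bounded below by
  \<open>x\<^sup>3\<close>, so the cubic coefficient of the lower bound is the rest of the coefficient sum \<open>P\<^sub>n(1)\<close>, the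
  number of partitions of \<open>n\<close>. It is only meaningful for \<open>n \<le> 20\<close>, where the table ends.
\<close>

definition lin_coeff :: "nat \<Rightarrow> real" where
  "lin_coeff n = divisor_sum n / n"

definition quad_coeff :: "nat \<Rightarrow> real" where
  "quad_coeff n = (\<Sum>k<n. divisor_sum (n - k) * lin_coeff k) / n"

definition partition_table :: "nat list" where
  "partition_table =
     [1, 1, 2, 3, 5, 7, 11, 15, 22, 30, 42, 56, 77, 101, 135, 176, 231, 297, 385, 490, 627]"

definition cub_coeff :: "nat \<Rightarrow> real" where
  "cub_coeff n = real (partition_table ! n) - lin_coeff n - quad_coeff n"

text \<open>This is the recurrence at \<open>x = 1\<close>; it makes the cubic coefficients in
  \<open>p_ge_cubic\<close> add up.\<close>

lemma partition_table_rec: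
  "\<forall>n\<in>set [1..<21]. n * partition_table ! n =
     sum_list (map (\<lambda>k. divisor_sum (n - k) * partition_table ! k) [0..<n])"
  by code_simp

lemma lin_coeff_nonneg: "lin_coeff n \<ge> 0"
  by (simp add: lin_coeff_def)

lemma quad_coeff_nonneg: "quad_coeff n \<ge> 0"
  by (simp add: quad_coeff_def lin_coeff_nonneg sum_nonneg)

text \<open>A finite check that supplies the base cases of \<open>p_ge_quadratic_growth\<close>. The
  bound is a falling factorial in \<open>n - 4\<close>, so its convolution with the identity has a
  closed form.\<close>

lemma cub_coeff_ge:
  assumes "n \<in> {4..20}"
  shows "(real n - 4) * (real n - 5) \<le> cub_coeff n"
proof -
  have "\<forall>n\<in>set [4..<21]. (real n - 4) * (real n - 5) \<le> cub_coeff n"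
    by (simp add: upt_rec cub_coeff_def lin_coeff_def quad_coeff_def
      partition_table_def divisor_sum_numeral lessThan_nat_numeral)
  from bspec[OF this, of n] show ?thesis
    using assms unfolding set_upt by simp
qed

lemma cub_coeff_nonneg:
  assumes "0 < n" "n < 21"
  shows "0 \<le> cub_coeff n"
proof (cases "n < 4")
  case True
  hence "n = 1 \<or> n = 2 \<or> n = 3" using assms by auto
  thus ?thesis
    by (auto simp: cub_coeff_def lin_coeff_def quad_coeff_def
      partition_table_def divisor_sum_numeral lessThan_nat_numeral)
next
  case False
  hence "0 \<le> (real n - 4) * (real n - 5)"
    by (cases "n = 4") auto
  also have "\<dots> \<le> cub_coeff n"
    using False assms by (intro cub_coeff_ge) auto
  finally show ?thesis .
qed

text \<open>Twice the binomial identity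
  \<open>(\<Sum>i<m. (m - i) * (i choose 2)) = (m + 1) choose 4\<close>.\<close>

lemma sum_weighted_falling:
  "(\<Sum>i<m. (real m - i) * (i * (real i - 1))) = (real m + 1) * m * (real m - 1) * (real m - 2) / 12"
proof (induction m)
  case (Suc m)
  have T: "(\<Sum>i<m. i * (real i - 1)) = m * (real m - 1) * (real m - 2) / 3"
    by (induction m) (simp_all add: field_simps)
  have "(\<Sum>i<Suc m. (real (Suc m) - i) * (i * (real i - 1))) =
      (\<Sum>i<m. (real m - i) * (i * (real i - 1)) + i * (real i - 1)) + m * (real m - 1)"
    by (simp add: algebra_simps)
  also have "\<dots> = (real m + 1) * m * (real m - 1) * (real m - 2) / 12
      + m * (real m - 1) * (real m - 2) / 3 + m * (real m - 1)"
    by (simp only: sum.distrib Suc.IH T)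
  finally show ?case
    by (simp add: field_simps)
qed simp

context colored_partition_values
begin

text \<open>The recurrence multiplies the bounds for the earlier \<open>p k\<close> by
  \<open>x\<close> and so raises degrees by one. The term \<open>k = 0\<close> gives the linear
  part, the linear parts give the quadratic one, and everything else is collected in
  \<open>x ^ 3\<close>.\<close>

lemma p_ge_cubic:
  assumes x: "x \<ge> 1" and n: "0 < n" "n < 21"
  shows "lin_coeff n * x + quad_coeff n * x ^ 2 + cub_coeff n * x ^ 3 \<le> p n"
  using n
proof (induction n rule: less_induct)
  case (less n)
  define s where "s k = real (divisor_sum (n - k))" for k
  have "real (\<Sum>k<n. divisor_sum (n - k) * partition_table ! k) = real (n * partition_table ! n)"
    using partition_table_rec less.prems by (simp add: interv_sum_list_conv_sum_set_nat lessThan_atLeast0)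
  hence table: "(\<Sum>k<n. s k * real (partition_table ! k)) = n * real (partition_table ! n)"
    by (simp add: s_def)
  have quad_n: "n * quad_coeff n = (\<Sum>k<n. s k * lin_coeff k)"
    using less.prems by (simp add: quad_coeff_def s_def)
  have lin_n: "s 0 = n * lin_coeff n"
    using less.prems by (simp add: lin_coeff_def s_def)
  have first: "s 0 * real (partition_table ! 0) = s 0" by (simp add: partition_table_def)
  have split: "{..<n} = insert 0 {1..<n}" using less.prems by auto
  have "(\<Sum>k=1..<n. s k * (lin_coeff k * x ^ 2 + (partition_table ! k - lin_coeff k) * x ^ 3)) \<le> x * (\<Sum>k=1..<n. s k * p k)"
    unfolding sum_distrib_left
  proof (intro sum_mono)
    fix k assume k: "k \<in> {1..<n}"
    \<comment> \<open>This lowers \<open>x ^ 4\<close> to \<open>x ^ 3\<close>, for which the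
      coefficient has to be nonnegative.\<close>
    have "cub_coeff k * x ^ 3 \<le> x * (cub_coeff k * x ^ 3)"
      using mult_right_mono[of 1 x "cub_coeff k * x ^ 3"] x k less.prems cub_coeff_nonneg[of k] by simp
    hence "lin_coeff k * x ^ 2 + (partition_table ! k - lin_coeff k) * x ^ 3 \<le>
        x * (lin_coeff k * x + quad_coeff k * x ^ 2 + cub_coeff k * x ^ 3)"
      by (simp add: cub_coeff_def algebra_simps power2_eq_square power3_eq_cube)
    also have "\<dots> \<le> x * p k"
      using x k less.prems by (intro mult_left_mono less.IH) auto
    finally show "s k * (lin_coeff k * x ^ 2 + (partition_table ! k - lin_coeff k) * x ^ 3) \<le> x * (s k * p k)"
      using mult_left_mono[of _ _ "s k"] by (fastforce simp: s_def mult_ac)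
  qed
  hence "s 0 * x + (\<Sum>k=1..<n. s k * (lin_coeff k * x ^ 2 + (partition_table ! k - lin_coeff k) * x ^ 3)) \<le> n * p n"
    unfolding p_rec split by (simp add: p_0 s_def algebra_simps)
  also have "(\<Sum>k=1..<n. s k * (lin_coeff k * x ^ 2 + (partition_table ! k - lin_coeff k) * x ^ 3)) =
    (\<Sum>k=1..<n. s k * lin_coeff k) * x ^ 2 + ((\<Sum>k=1..<n. s k * partition_table ! k) - (\<Sum>k=1..<n. s k * lin_coeff k)) * x ^ 3"
    by (simp add: sum_distrib_left sum_distrib_right sum_subtractf sum.distrib algebra_simps)
  \<comment> \<open>The term \<open>k = 0\<close> is absent here, but \<open>lin_coeff 0\<close> is
    0 because it is a division by zero.\<close>
  also have "(\<Sum>k=1..<n. s k * lin_coeff k) = n * quad_coeff n"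
    using quad_n unfolding split by (simp add: lin_coeff_def)
  also have "(\<Sum>k=1..<n. s k * partition_table ! k) = n * partition_table ! n - s 0"
    using table first unfolding split by simp
  also have "s 0 = n * lin_coeff n" by (rule lin_n)
  finally have "n * (lin_coeff n * x + quad_coeff n * x ^ 2 + cub_coeff n * x ^ 3) \<le> n * p n"
    by (simp add: cub_coeff_def algebra_simps)
  thus ?case
    using less.prems by simp
qed

text \<open>
  The bound \<open>\<sigma>(k) \<ge> k\<close> in the recurrence reproduces the quadratic growth only from \<open>n = 21\<close> on; this
  determines the length of the table.
\<close>

lemma p_ge_quadratic_growth:
  assumes x: "x \<ge> 1" and n: "n \<ge> 4"
  shows "(real n - 4) * (real n - 5) * x ^ 3 \<le> p n"
  using n
proof (induction n rule: less_induct)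
  case (less n)
  show ?case
  proof (cases "n \<le> 20")
    case True
    have "(real n - 4) * (real n - 5) * x ^ 3 \<le> cub_coeff n * x ^ 3"
      using x less.prems True by (intro mult_right_mono cub_coeff_ge) auto
    also have "\<dots> \<le> lin_coeff n * x + quad_coeff n * x ^ 2 + cub_coeff n * x ^ 3"
      using x by (simp add: lin_coeff_nonneg quad_coeff_nonneg)
    also have "\<dots> \<le> p n"
      using less.prems True x by (intro p_ge_cubic) auto
    finally show ?thesis .
  next
    case False
    define m where "m = n - 4"
    have m: "n = m + 4" "m \<ge> 17" using False by (auto simp: m_def)
    have "n * ((real n - 4) * (real n - 5)) = real (m + 4) * (m * (real m - 1))"
      by (simp add: m)
    also have "\<dots> \<le> ((real m + 1) * (real m - 2) / 12) * (m * (real m - 1))"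
    proof (intro mult_right_mono)
      \<comment> \<open>The goal amounts to \<open>m ^ 2 - 13 * m - 50 \<ge> 0\<close>, whose left
        side exceeds this product by \<open>m + 1\<close>. It fails for
        \<open>m = 16\<close>.\<close>
      have "0 \<le> (real m - 17) * (real m + 3)"
        using m by simp
      thus "real (m + 4) \<le> (real m + 1) * (real m - 2) / 12"
        using m by (simp add: algebra_simps)
    qed (use m in auto)
    also have "\<dots> = (\<Sum>i<m. (real m - i) * (i * (real i - 1)))"
      unfolding sum_weighted_falling by simp
    finally have "n * ((real n - 4) * (real n - 5)) * x ^ 3 \<le>
        (\<Sum>i<m. (real m - i) * (i * (real i - 1))) * x ^ 3"
      using x by (intro mult_right_mono) auto
    also have "\<dots> = (\<Sum>i<m. (real m - i) * (i * (real i - 1) * x ^ 3))"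
      by (simp only: sum_distrib_right mult.assoc)
    \<comment> \<open>The index is \<open>k = i + 4\<close>: only terms with
      \<open>k \<ge> 4\<close> are used, where the induction hypothesis is available.\<close>
    also have "\<dots> \<le> (\<Sum>i<m. real (divisor_sum (m - i)) * p (i + 4))"
    proof (intro sum_mono mult_mono)
      fix i assume i: "i \<in> {..<m}"
      have "real m - real i = real (m - i)" using i by simp
      also have "\<dots> \<le> divisor_sum (m - i)"
        using le_divisor_sum by simp
      finally show "real m - real i \<le> divisor_sum (m - i)" .
      show "i * (real i - 1) * x ^ 3 \<le> p (i + 4)"
        using less.IH[of "i + 4"] i by (simp add: m)
      show "0 \<le> i * (real i - 1) * x ^ 3"
        using x by (cases i) auto
    qed auto
    also have "\<dots> = (\<Sum>k=4..<n. divisor_sum (n - k) * p k)"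
      using sum.shift_bounds_nat_ivl[of "\<lambda>k. divisor_sum (n - k) * p k" 0 4 m]
      by (simp add: m lessThan_atLeast0)
    also have "\<dots> \<le> (\<Sum>k<n. divisor_sum (n - k) * p k)"
      using x by (intro sum_mono2) (auto intro!: mult_nonneg_nonneg p_nonneg)
    also have "\<dots> \<le> x * \<dots>"
      using mult_right_mono[of 1 x "\<Sum>k<n. divisor_sum (n - k) * p k"] x by (simp add: sum_nonneg p_nonneg)
    also have "\<dots> = n * p n"
      by (rule p_rec[symmetric])
    finally have "n * ((real n - 4) * (real n - 5) * x ^ 3) \<le> n * p n"
      by (simp add: mult_ac)
    thus ?thesis
      by (rule mult_left_le_imp_le) (simp add: m)
  qed
qed

end

section \<open>The induction step as positivity of a polynomial\<close>

text \<open>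
  Let \<open>A x + B x\<^sup>2 + C x\<^sup>3\<close> be a lower bound for \<open>P\<^bsub>n-1\<^esub>\<close>. After clearing denominators, the inequality
  needed in the induction step is the positivity of a polynomial in \<open>x\<close>. The expressions below are
  its coefficients with respect to \<open>x - 1\<close> (for \<open>b = 2\<close>: \<open>x - 2\<close>). For \<open>b = 2\<close> and \<open>n = 4\<close> the constant
  coefficient vanishes, so there it is the linear one that has to be positive.
\<close>

definition step_cond_1 :: "real \<Rightarrow> real \<Rightarrow> real \<Rightarrow> nat \<Rightarrow> bool" where
  "step_cond_1 A B C n \<longleftrightarrow> (let s0 = divisor_sum n; s1 = divisor_sum (n - 1);
       q0 = A + B + C; q1 = B + 2 * C in
     0 < 4 * q0 + 2 * s1 - 2 * s0 \<and> 0 \<le> q0 + 4 * q1 - s1 \<and> 0 \<le> q1 + 4 * C \<and> 0 \<le> C)"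

definition step_cond_2 :: "real \<Rightarrow> real \<Rightarrow> real \<Rightarrow> nat \<Rightarrow> bool" where
  "step_cond_2 A B C n \<longleftrightarrow> (let s0 = divisor_sum n; s1 = divisor_sum (n - 1); s2 = divisor_sum (n - 2);
       q0 = A + 2 * B + 4 * C; q1 = B + 4 * C in
     0 \<le> 60 * q0 - 30 * s2 - 30 * s0 \<and>
     0 < 26 * q0 + 60 * q1 - 23 * s2 - 16 * s1 - 6 * s0 \<and>
     0 \<le> 2 * q0 + 26 * q1 + 60 * C - 6 * s2 - 4 * s1 \<and>
     0 \<le> 2 * q1 + 26 * C - s2 \<and> 0 \<le> 2 * C)"

definition step_cond_3 :: "real \<Rightarrow> real \<Rightarrow> real \<Rightarrow> nat \<Rightarrow> bool" where
  "step_cond_3 A B C n \<longleftrightarrow> (let s0 = divisor_sum n; s1 = divisor_sum (n - 1); s2 = divisor_sum (n - 2);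
       s3 = divisor_sum (n - 3); q0 = A + B + C; q1 = B + 2 * C in
     0 < 360 * q0 + 72 * s3 - 72 * s2 + 144 * s1 - 216 * s0 \<and>
     0 \<le> 114 * q0 + 360 * q1 + 12 * s3 - 114 * s2 - 126 * s1 - 24 * s0 \<and>
     0 \<le> 6 * q0 + 114 * q1 + 360 * C - 71 * s3 - 48 * s2 - 18 * s1 \<and>
     0 \<le> 6 * q1 + 114 * C - 12 * s3 - 6 * s2 \<and> 0 \<le> 6 * C - s3)"

text \<open>A finite check: each range starts at \<open>b + 2\<close> and stops where
  \<open>step_cond_large\<close> takes over.\<close>

lemma step_cond_small:
  "\<forall>n\<in>set [3..<12]. step_cond_1 (lin_coeff (n - 1)) (quad_coeff (n - 1)) (cub_coeff (n - 1)) n"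
  "\<forall>n\<in>set [4..<12]. step_cond_2 (lin_coeff (n - 1)) (quad_coeff (n - 1)) (cub_coeff (n - 1)) n"
  "\<forall>n\<in>set [5..<12]. step_cond_3 (lin_coeff (n - 1)) (quad_coeff (n - 1)) (cub_coeff (n - 1)) n"
  by (simp_all add: upt_rec step_cond_1_def step_cond_2_def step_cond_3_def cub_coeff_def lin_coeff_def quad_coeff_def
    partition_table_def divisor_sum_numeral lessThan_nat_numeral)

text \<open>Here \<open>C\<close> is the coefficient from \<open>p_ge_quadratic_growth\<close> at
  \<open>n - 1\<close>. Once all divisor sums are bounded by \<open>N\<close>, the most demanding
  condition is the constant one of \<open>step_cond_3\<close>, where
  \<open>360 * C > 288 * N\<close> suffices.\<close>

lemma step_cond_large:
  assumes n: "n \<ge> 12"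
  defines "C \<equiv> (real n - 5) * (real n - 6)"
  shows "step_cond_1 0 0 C n" "step_cond_2 0 0 C n" "step_cond_3 0 0 C n"
proof -
  define N where "N = real n ^ 2 / 8 + 5 * n / 4"
  have s: "real (divisor_sum (n - i)) \<le> N" for i
  proof -
    have "real (divisor_sum (n - i)) \<le> real (n - i) ^ 2 / 8 + 5 * real (n - i) / 4"
      by (rule divisor_sum_le)
    also have "\<dots> \<le> N"
      unfolding N_def by (intro add_mono divide_right_mono mult_left_mono power_mono) auto
    finally show ?thesis .
  qed
  \<comment> \<open>\<open>8 * (4 * C - 5 * N)\<close> equals this product plus 24.\<close>
  have "0 \<le> (real n - 12) * (27 * real n - 78)"
    using n by (intro mult_nonneg_nonneg) auto
  hence C: "5 * N \<le> 4 * C"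
    unfolding N_def C_def by (simp add: field_simps power2_eq_square)
  have N: "N > 0"
    using n by (simp add: N_def add_pos_pos)
  define s0 s1 s2 s3 where "s0 = real (divisor_sum n)" and "s1 = real (divisor_sum (n - 1))"
    and "s2 = real (divisor_sum (n - 2))" and "s3 = real (divisor_sum (n - 3))"
  note cond_defs = step_cond_1_def step_cond_2_def step_cond_3_def Let_def
    s0_def[symmetric] s1_def[symmetric] s2_def[symmetric] s3_def[symmetric]
  have bounds: "0 \<le> s0" "0 \<le> s1" "0 \<le> s2" "0 \<le> s3" "s0 \<le> N" "s1 \<le> N" "s2 \<le> N" "s3 \<le> N"
    using s[of 0] s[of 1] s[of 2] s[of 3] by (auto simp: s0_def s1_def s2_def s3_def)
  show "step_cond_1 0 0 C n"
    using bounds C N unfolding cond_defs by auto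
  show "step_cond_2 0 0 C n"
    using bounds C N unfolding cond_defs by auto
  show "step_cond_3 0 0 C n"
    using bounds C N unfolding cond_defs by auto
qed

lemma quartic_pos:
  fixes t :: real
  assumes "t > 0" "c0 \<ge> 0" "c1 \<ge> 0" "c0 > 0 \<or> c1 > 0" "c2 \<ge> 0" "c3 \<ge> 0" "c4 \<ge> 0"
  shows "0 < c0 + c1 * t + c2 * t ^ 2 + c3 * t ^ 3 + c4 * t ^ 4"
proof -
  have "0 < c0 + c1 * t"
    using assms by (auto intro: add_pos_nonneg add_nonneg_pos)
  moreover have "0 \<le> c2 * t ^ 2" "0 \<le> c3 * t ^ 3" "0 \<le> c4 * t ^ 4"
    using assms by auto
  ultimately show ?thesis by linarith
qed

text \<open>The factor \<open>(x + 3) / 2\<close> is \<open>p 2 / p 1\<close>. Multiplying by 2 and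
  cancelling \<open>x\<close> leaves a cubic, which is expanded at \<open>x = 1\<close>.\<close>

lemma ratio_step_1:
  fixes x :: real
  assumes x: "x > 1" and y: "A * x + B * x ^ 2 + C * x ^ 3 \<le> y" and cond: "step_cond_1 A B C n"
  shows "x * divisor_sum n < (x + 3) / 2 * y + x * (divisor_sum (n - 1) * ((x + 3) / 2 - x))"
proof -
  define t where "t = x - 1"
  define s0 s1 where "s0 = real (divisor_sum n)" and "s1 = real (divisor_sum (n - 1))"
  have x_eq: "x = 1 + t" and t: "t > 0" using x by (auto simp: t_def)
  have "0 < (4 * (A + B + C) + 2 * s1 - 2 * s0) + ((A + B + C) + 4 * (B + 2 * C) - s1) * t
      + ((B + 2 * C) + 4 * C) * t ^ 2 + C * t ^ 3 + 0 * t ^ 4"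
    using cond t unfolding step_cond_1_def Let_def s0_def s1_def by (intro quartic_pos) auto
  also have "\<dots> = (x + 3) * (A + B * x + C * x ^ 2) + s1 * (3 - x) - 2 * s0"
    by (simp add: x_eq algebra_simps power2_eq_square power3_eq_cube)
  finally have "0 < x * ((x + 3) * (A + B * x + C * x ^ 2) + s1 * (3 - x) - 2 * s0)"
    using x by (intro mult_pos_pos) auto
  moreover have "(x + 3) * (A * x + B * x ^ 2 + C * x ^ 3) \<le> (x + 3) * y"
    using x y by (intro mult_left_mono) auto
  ultimately have "x * s0 < (x + 3) / 2 * y + x * (s1 * ((x + 3) / 2 - x))"
    by (simp add: field_simps power2_eq_square power3_eq_cube)
  thus ?thesis
    unfolding s0_def s1_def .
qed

text \<open>Here \<open>c\<close> is \<open>p 3 / p 2\<close>, and \<open>6 * (x + 3)\<close> clears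
  all denominators. The expansion is at \<open>x = 2\<close>, where equality occurs for
  \<open>n = 4\<close>: the values of \<open>p 2\<close>, \<open>p 3\<close>, \<open>p 4\<close>
  there are 5, 10, 20.\<close>

lemma ratio_step_2:
  fixes x :: real
  assumes x: "x > 2" and y: "A * x + B * x ^ 2 + C * x ^ 3 \<le> y" and cond: "step_cond_2 A B C n"
  defines "c \<equiv> (x + 1) * (x + 8) / (3 * (x + 3))"
  shows "x * divisor_sum n < c * y + x * (divisor_sum (n - 1) * (c - x) +
    divisor_sum (n - 2) * (c * x - x * (x + 3) / 2))"
proof -
  define t where "t = x - 2"
  define s0 s1 s2 where "s0 = real (divisor_sum n)" and "s1 = real (divisor_sum (n - 1))"
    and "s2 = real (divisor_sum (n - 2))"
  have x_eq: "x = 2 + t" and t: "t > 0" using x by (auto simp: t_def)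
  have "0 < (60 * (A + 2 * B + 4 * C) - 30 * s2 - 30 * s0)
      + (26 * (A + 2 * B + 4 * C) + 60 * (B + 4 * C) - 23 * s2 - 16 * s1 - 6 * s0) * t
      + (2 * (A + 2 * B + 4 * C) + 26 * (B + 4 * C) + 60 * C - 6 * s2 - 4 * s1) * t ^ 2
      + (2 * (B + 4 * C) + 26 * C - s2) * t ^ 3 + 2 * C * t ^ 4"
    using cond t unfolding step_cond_2_def Let_def s0_def s1_def s2_def by (intro quartic_pos) auto
  also have "\<dots> = 2 * (x + 1) * (x + 8) * (A + B * x + C * x ^ 2) - s2 * (x * (x ^ 2 + 11))
      - s1 * (4 * (x ^ 2 - 4)) - 6 * (x + 3) * s0"
    by (simp add: x_eq algebra_simps power2_eq_square power3_eq_cube power4_eq_xxxx)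
  finally have "0 < x * (2 * (x + 1) * (x + 8) * (A + B * x + C * x ^ 2) - s2 * (x * (x ^ 2 + 11))
      - s1 * (4 * (x ^ 2 - 4)) - 6 * (x + 3) * s0)"
    using x by (intro mult_pos_pos) auto
  moreover have "2 * (x + 1) * (x + 8) * (A * x + B * x ^ 2 + C * x ^ 3) \<le> 2 * (x + 1) * (x + 8) * y"
    using x y by (intro mult_left_mono) auto
  moreover have "6 * (x + 3) * (c * y + x * (s1 * (c - x) + s2 * (c * x - x * (x + 3) / 2))) =
      2 * (x + 1) * (x + 8) * y - x * (s1 * (4 * (x ^ 2 - 4)) + s2 * (x * (x ^ 2 + 11)))"
  proof -
    have c: "6 * (x + 3) * c = 2 * (x + 1) * (x + 8)"
      using x by (simp add: c_def field_simps)
    \<comment> \<open>\<open>1\<close> and \<open>2\<close> are the differences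
      \<open>c * p (j - 1) - p j\<close> for \<open>j = 1, 2\<close> with denominators
      cleared.\<close>
    have 1: "6 * (x + 3) * (c - x) = - (4 * (x ^ 2 - 4))"
      using c by (simp add: algebra_simps power2_eq_square)
    have 2: "6 * (x + 3) * (c * x - x * (x + 3) / 2) = - (x * (x ^ 2 + 11))"
      using arg_cong[OF c, of "\<lambda>u. u * x"] by (simp add: field_simps power2_eq_square)
    have "6 * (x + 3) * (c * y + x * (s1 * (c - x) + s2 * (c * x - x * (x + 3) / 2))) =
        6 * (x + 3) * c * y + x * (s1 * (6 * (x + 3) * (c - x)) +
          s2 * (6 * (x + 3) * (c * x - x * (x + 3) / 2)))"
      by (simp only: algebra_simps)
    thus ?thesis
      unfolding c 1 2 by (simp add: algebra_simps)
  qed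
  ultimately have "6 * (x + 3) * (x * s0) <
      6 * (x + 3) * (c * y + x * (s1 * (c - x) + s2 * (c * x - x * (x + 3) / 2)))"
    by (simp add: algebra_simps power2_eq_square power3_eq_cube)
  thus ?thesis
    using x unfolding s0_def s1_def s2_def by (subst (asm) mult_less_cancel_left_pos) auto
qed

text \<open>Same scheme with \<open>c = p 4 / p 3\<close> and common denominator
  \<open>24 * (x + 8)\<close>; cancelling \<open>x\<close> leaves a quartic, expanded at
  \<open>x = 1\<close>.\<close>

lemma ratio_step_3:
  fixes x :: real
  assumes x: "x > 1" and y: "A * x + B * x ^ 2 + C * x ^ 3 \<le> y" and cond: "step_cond_3 A B C n"
  defines "c \<equiv> (x + 3) * (x + 14) / (4 * (x + 8))"
  shows "x * divisor_sum n < c * y + x * (divisor_sum (n - 1) * (c - x) +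
    divisor_sum (n - 2) * (c * x - x * (x + 3) / 2) +
    divisor_sum (n - 3) * (c * (x * (x + 3) / 2) - x * (x + 1) * (x + 8) / 6))"
proof -
  define t where "t = x - 1"
  define s0 s1 s2 s3 where "s0 = real (divisor_sum n)" and "s1 = real (divisor_sum (n - 1))"
    and "s2 = real (divisor_sum (n - 2))" and "s3 = real (divisor_sum (n - 3))"
  define r where "r = c * y + x * (s1 * (c - x) + s2 * (c * x - x * (x + 3) / 2) +
    s3 * (c * (x * (x + 3) / 2) - x * (x + 1) * (x + 8) / 6))"
  have x_eq: "x = 1 + t" and t: "t > 0" using x by (auto simp: t_def)
  have "0 < (360 * (A + B + C) + 72 * s3 - 72 * s2 + 144 * s1 - 216 * s0)
      + (114 * (A + B + C) + 360 * (B + 2 * C) + 12 * s3 - 114 * s2 - 126 * s1 - 24 * s0) * t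
      + (6 * (A + B + C) + 114 * (B + 2 * C) + 360 * C - 71 * s3 - 48 * s2 - 18 * s1) * t ^ 2
      + (6 * (B + 2 * C) + 114 * C - 12 * s3 - 6 * s2) * t ^ 3 + (6 * C - s3) * t ^ 4"
    using cond t unfolding step_cond_3_def Let_def s0_def s1_def s2_def s3_def by (intro quartic_pos) auto
  also have "\<dots> = 6 * (x + 3) * (x + 14) * (A + B * x + C * x ^ 2)
      - s3 * (x * (x ^ 3 + 8 * x ^ 2 + 41 * x - 122)) - s2 * (6 * x * (x + 2) * (x + 3))
      - s1 * (6 * (3 * x ^ 2 + 15 * x - 42)) - 24 * (x + 8) * s0"
    by (simp add: x_eq algebra_simps power2_eq_square power3_eq_cube power4_eq_xxxx)
  finally have "0 < x * (6 * (x + 3) * (x + 14) * (A + B * x + C * x ^ 2)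
      - s3 * (x * (x ^ 3 + 8 * x ^ 2 + 41 * x - 122)) - s2 * (6 * x * (x + 2) * (x + 3))
      - s1 * (6 * (3 * x ^ 2 + 15 * x - 42)) - 24 * (x + 8) * s0)"
    using x by (intro mult_pos_pos) auto
  moreover have "6 * (x + 3) * (x + 14) * (A * x + B * x ^ 2 + C * x ^ 3) \<le> 6 * (x + 3) * (x + 14) * y"
    using x y by (intro mult_left_mono) auto
  moreover have "24 * (x + 8) * r = 6 * (x + 3) * (x + 14) * y
      - x * (s1 * (6 * (3 * x ^ 2 + 15 * x - 42)) + s2 * (6 * x * (x + 2) * (x + 3))
        + s3 * (x * (x ^ 3 + 8 * x ^ 2 + 41 * x - 122)))"
  proof -
    have c: "24 * (x + 8) * c = 6 * (x + 3) * (x + 14)"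
      using x by (simp add: c_def field_simps)
    have 1: "24 * (x + 8) * (c - x) = - (6 * (3 * x ^ 2 + 15 * x - 42))"
      using c by (simp add: algebra_simps power2_eq_square)
    have 2: "24 * (x + 8) * (c * x - x * (x + 3) / 2) = - (6 * x * (x + 2) * (x + 3))"
      using arg_cong[OF c, of "\<lambda>u. u * x"] by (simp add: field_simps power2_eq_square)
    have 3: "24 * (x + 8) * (c * (x * (x + 3) / 2) - x * (x + 1) * (x + 8) / 6) =
        - (x * (x ^ 3 + 8 * x ^ 2 + 41 * x - 122))"
      using arg_cong[OF c, of "\<lambda>u. u * (x * (x + 3) / 2)"]
      by (simp add: field_simps power2_eq_square power3_eq_cube)
    have "24 * (x + 8) * r = 24 * (x + 8) * c * y + x * (s1 * (24 * (x + 8) * (c - x)) +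
        s2 * (24 * (x + 8) * (c * x - x * (x + 3) / 2)) +
        s3 * (24 * (x + 8) * (c * (x * (x + 3) / 2) - x * (x + 1) * (x + 8) / 6)))"
      unfolding r_def by (simp only: algebra_simps)
    thus ?thesis
      unfolding c 1 2 3 by (simp add: algebra_simps)
  qed
  ultimately have "24 * (x + 8) * (x * s0) < 24 * (x + 8) * r"
    by (simp add: algebra_simps power2_eq_square power3_eq_cube)
  thus ?thesis
    using x unfolding r_def s0_def s1_def s2_def s3_def by (subst (asm) mult_less_cancel_left_pos) auto
qed

section \<open>Combining the bounds into the inequality\<close>

context colored_partition_values
begin

text \<open>Joins the explicit bounds for \<open>n < 12\<close> with the uniform one;
  \<open>S\<close> is a variable so that all three step conditions fit.\<close>

lemma obtain_cubic_bound:
  assumes "x \<ge> 1" "2 \<le> k" "k \<le> n"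
    and "\<forall>n\<in>set [k..<12]. S (lin_coeff (n - 1)) (quad_coeff (n - 1)) (cub_coeff (n - 1)) n"
    and "n \<ge> 12 \<Longrightarrow> S 0 0 ((real n - 5) * (real n - 6)) n"
  obtains A B C where "A * x + B * x ^ 2 + C * x ^ 3 \<le> p (n - 1)" "S A B C n"
proof (cases "n < 12")
  case True
  show thesis
  proof (rule that)
    show "S (lin_coeff (n - 1)) (quad_coeff (n - 1)) (cub_coeff (n - 1)) n"
      using assms True unfolding set_upt by simp
    show "lin_coeff (n - 1) * x + quad_coeff (n - 1) * x ^ 2 + cub_coeff (n - 1) * x ^ 3 \<le> p (n - 1)"
      using assms True by (intro p_ge_cubic) auto
  qed
next
  case False
  show thesis
  proof (rule that)
    show "S 0 0 ((real n - 5) * (real n - 6)) n"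
      using assms False by simp
    show "0 * x + 0 * x ^ 2 + (real n - 5) * (real n - 6) * x ^ 3 \<le> p (n - 1)"
      using p_ge_quadratic_growth[of "n - 1"] assms False by (simp add: of_nat_diff)
  qed
qed

lemma ratio_less:
  assumes b: "b \<in> {1, 2, 3}" and x: "x > (if odd b then 1 else 2)" and n: "n \<ge> b + 2"
  shows "p n < p (b + 1) / p b * p (n - 1)"
proof -
  \<comment> \<open>The small values are also recorded with indices in \<open>Suc\<close> form, as
    they arise when the sums over \<open>{1..b}\<close> are unfolded.\<close>
  note ps = p_0 p_small p_small[unfolded One_nat_def numeral_2_eq_2 numeral_3_eq_3]
  have x1: "x > 1" using x by (auto split: if_splits)
  consider "b = 1" | "b = 2" | "b = 3" using b by auto
  thus ?thesis
  proof cases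
    case 1
    have ratio: "p (b + 1) / p b = (x + 3) / 2"
      using x1 by (simp add: 1 ps)
    show ?thesis
      unfolding ratio
    proof (rule ratio_induct[OF _ _ _ n])
      fix n assume n: "n \<ge> b + 2"
      obtain A B C where "A * x + B * x ^ 2 + C * x ^ 3 \<le> p (n - 1)" "step_cond_1 A B C n"
        by (rule obtain_cubic_bound[where S = step_cond_1, OF _ _ _ step_cond_small(1), of n])
          (use x1 n 1 step_cond_large in auto)
      from ratio_step_1[OF x1 this] show "x * divisor_sum n < (x + 3) / 2 * p (n - 1) +
          x * (\<Sum>j=1..b. divisor_sum (n - j) * ((x + 3) / 2 * p (j - 1) - p j))"
        by (simp add: 1 ps)
    qed (use x1 in \<open>simp_all add: 1 ps\<close>)
  next
    case 2
    define c where "c = (x + 1) * (x + 8) / (3 * (x + 3))"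
    have x2: "x > 2" using x 2 by simp
    have start: "p (b + 1) = c * p b"
      using x1 by (simp add: 2 c_def ps field_simps)
    have "p b \<noteq> 0"
      using x1 by (simp add: 2 ps)
    hence ratio: "p (b + 1) / p b = c"
      unfolding start by (rule nonzero_mult_div_cancel_right)
    show ?thesis
      unfolding ratio
    proof (rule ratio_induct[OF _ start _ n])
      fix n assume n: "n \<ge> b + 2"
      obtain A B C where "A * x + B * x ^ 2 + C * x ^ 3 \<le> p (n - 1)" "step_cond_2 A B C n"
        by (rule obtain_cubic_bound[where S = step_cond_2, OF _ _ _ step_cond_small(2), of n])
          (use x1 n 2 step_cond_large in auto)
      from ratio_step_2[OF x2 this, folded c_def] show "x * divisor_sum n < c * p (n - 1) +
          x * (\<Sum>j=1..b. divisor_sum (n - j) * (c * p (j - 1) - p j))"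
        by (simp add: 2 ps numeral_2_eq_2)
    qed (use x1 in simp)
  next
    case 3
    define c where "c = (x + 3) * (x + 14) / (4 * (x + 8))"
    have start: "p (b + 1) = c * p b"
      using x1 by (simp add: 3 c_def ps field_simps)
    have "p b \<noteq> 0"
      using x1 by (simp add: 3 ps)
    hence ratio: "p (b + 1) / p b = c"
      unfolding start by (rule nonzero_mult_div_cancel_right)
    show ?thesis
      unfolding ratio
    proof (rule ratio_induct[OF _ start _ n])
      fix n assume n: "n \<ge> b + 2"
      obtain A B C where "A * x + B * x ^ 2 + C * x ^ 3 \<le> p (n - 1)" "step_cond_3 A B C n"
        by (rule obtain_cubic_bound[where S = step_cond_3, OF _ _ _ step_cond_small(3), of n])
          (use x1 n 3 step_cond_large in auto)
      from ratio_step_3[OF x1 this, folded c_def] show "x * divisor_sum n < c * p (n - 1) +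
          x * (\<Sum>j=1..b. divisor_sum (n - j) * (c * p (j - 1) - p j))"
        by (simp add: 3 ps numeral_2_eq_2 numeral_3_eq_3)
    qed (use x1 in simp)
  qed
qed

end

theorem theorem2:
  fixes a b a0 :: nat and x x0 :: real
  assumes "b \<in> {1, 2, 3}"
    and "x0 = (if odd b then 1 else 2)"
    and "a0 = b + 2"
    and "a \<ge> a0"
    and "x > x0"
  shows "Delta a b x > 0"
proof -
  define p where "p n = poly (colored_partition_poly n) x" for n
  interpret colored_partition_values x p
    by unfold_locales (simp_all add: p_def poly_colored_partition_poly_0 poly_colored_partition_poly_rec)
  have "x > 1"
    using assms by (auto split: if_splits)
  hence "p b > 0"
    using assms(1) by (auto simp: p_small p_small(1)[simplified])
  moreover have "p a < p (b + 1) / p b * p (a - 1)"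
    using assms by (intro ratio_less) auto
  ultimately show ?thesis
    by (simp add: Delta_def field_simps flip: p_def)
qed

end
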